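(* Let $G$ be a (not necessarily connected) semi-balanced directed graph and let $C$ be a cycle in $G$. Let $C^+$ denote the set of those edges of $C$ that point in one (fixed) of the two cyclic directions. Then \[\sum_{S\subset C^+}(-1)^{|S|}I_{G-S}=0,\] where the sum is over all subsets $S$ of $C^+$, including the empty set, and $G-S$ is the graph on the same vertex set obtained by deleting the edges in $S$.
   Context: A directed graph is an orientation of a finite graph without loops and multiple edges; $\overrightarrow{th}$ denotes an edge with tail $t$ and head $h$. Connectedness and cycles are meant in the underlying undirected graph. A cycle is semi-balanced if it has the same number of edges going in the two directions around the cycle; a directed graph is semi-balanced if all of its cycles are semi-balanced. For a directed graph $G=(V,E)$ let $\mathbf{v}\in\mathbf{R}^V$ be the standard basis vector of $v\in V$. The root polytope is $\mathcal{Q}_G=\mathrm{Conv}\{\mathbf{h}-\mathbf{t}\mid \overrightarrow{th}\in E\}\subset\mathbf{R}^V$. Its Ehrhart series is $\mathrm{Ehr}_{\mathcal{Q}_G}(t)=\sum_{k=0}^\infty |(k\cdot\mathcal{Q}_G)\cap\mathbf{Z}^V|\,t^k$ (with constant term $1$). The interior polynomial of a (not necessarily connected) semi-balanced graph $G$ with vertex set $V$ is \[I_G(t)=(1-t)^{|V|-1}\,\mathrm{Ehr}_{\mathcal{Q}_G}(t).\] Equivalently $I_G(t)=(1-t)^{c(G)-1}h^*_{\mathcal{Q}_G}(t)$, where $c(G)$ is the number of connected components and $h^*_{Q}(t)=(1-t)^{\dim Q+1}\mathrm{Ehr}_Q(t)$. *)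

theory Defs
  imports "HOL-Analysis.Analysis" "HOL-Computational_Algebra.Formal_Power_Series"
begin

text \<open>
  The vertex set of a graph is the whole of a finite type, so that \<open>\<real>\<^sup>V\<close> is the type
  \<open>real ^ 'v\<close>. A graph is then given by its set of edges, where \<open>(t, h)\<close> is the edge
  with tail \<open>t\<close> and head \<open>h\<close>; deleting edges keeps the vertex set.
\<close>

definition oriented_graph :: "('v \<times> 'v) set \<Rightarrow> bool" where
  "oriented_graph E \<longleftrightarrow> (\<forall>(t, h) \<in> E. t \<noteq> h \<and> (h, t) \<notin> E)"

text \<open>
  A cycle of the underlying undirected graph is given by the list of its vertices in the
  order of a traversal. The list thus also fixes one of the two cyclic directions; the other
  one is given by the reversed list.
\<close>

definition cycle_steps :: "'v list \<Rightarrow> ('v \<times> 'v) set" where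
  "cycle_steps vs = {(vs ! i, vs ! (Suc i mod length vs)) | i. i < length vs}"

definition is_cycle :: "('v \<times> 'v) set \<Rightarrow> 'v list \<Rightarrow> bool" where
  "is_cycle E vs \<longleftrightarrow> 3 \<le> length vs \<and> distinct vs \<and> cycle_steps vs \<subseteq> E \<union> E\<inverse>"

definition forward_edges :: "('v \<times> 'v) set \<Rightarrow> 'v list \<Rightarrow> ('v \<times> 'v) set" where
  "forward_edges E vs = E \<inter> cycle_steps vs"

definition backward_edges :: "('v \<times> 'v) set \<Rightarrow> 'v list \<Rightarrow> ('v \<times> 'v) set" where
  "backward_edges E vs = E \<inter> (cycle_steps vs)\<inverse>"

definition semi_balanced :: "('v \<times> 'v) set \<Rightarrow> bool" where
  "semi_balanced E \<longleftrightarrow>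
     (\<forall>vs. is_cycle E vs \<longrightarrow> card (forward_edges E vs) = card (backward_edges E vs))"

definition root_polytope :: "('v::finite \<times> 'v) set \<Rightarrow> (real ^ 'v) set" where
  "root_polytope E = convex hull {axis h 1 - axis t 1 | t h. (t, h) \<in> E}"

definition integer_points :: "(real ^ 'v::finite) set" where
  "integer_points = {x. \<forall>i. x $ i \<in> \<int>}"

text \<open>
  The constant term is 1 by convention. The case distinction only matters for
  \<open>Q = {}\<close>, the root polytope of a graph without edges.
\<close>

definition ehrhart_series :: "(real ^ 'v::finite) set \<Rightarrow> int fps" where
  "ehrhart_series Q =
     Abs_fps (\<lambda>k. if k = 0 then 1 else int (card ((\<lambda>x. real k *\<^sub>R x) ` Q \<inter> integer_points)))"

definition interior_polynomial :: "('v::finite \<times> 'v) set \<Rightarrow> int fps" where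
  "interior_polynomial E = (1 - fps_X) ^ (CARD('v) - 1) * ehrhart_series (root_polytope E)"

end

theory Submission imports Defs begin

text \<open>
  Let \<open>C\<^sup>+\<close> and \<open>C\<^sup>-\<close> be the edges of the cycle in its two directions. Comparing coefficients,
  it suffices to show, for each \<open>k > 0\<close> and each point \<open>x\<close>, that
  \<open>\<Sum>S\<subseteq>C\<^sup>+. (-1)\<^bsup>|S|\<^esup> [x \<in> k Q\<^bsub>G-S\<^esub>] = 0\<close>. Now \<open>x \<in> k Q\<^bsub>G-S\<^esub>\<close> means that the polytope \<open>P\<^bsub>S\<^esub>\<close> of
  nonnegative flows of total weight \<open>k\<close> with excess \<open>x\<close> that vanish outside \<open>E - S\<close> is nonempty.

  Let \<open>\<gamma>\<close> be the circulation that is \<open>1\<close> on \<open>C\<^sup>+\<close> and \<open>-1\<close> on \<open>C\<^sup>-\<close>. Since the cycle is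
  semi-balanced, adding a multiple of \<open>\<gamma>\<close> to a flow changes neither its excess nor its total
  weight. Project the space of flows along \<open>\<gamma>\<close>. A line parallel to \<open>\<gamma>\<close> that meets \<open>P\<^bsub>{}\<^esub>\<close> has
  exactly one point \<open>p\<close> where the minimum over \<open>C\<^sup>+\<close> is \<open>0\<close>; this point lies in \<open>P\<^bsub>{}\<^esub>\<close>, because
  lowering the flow on \<open>C\<^sup>+\<close> raises it on \<open>C\<^sup>-\<close>. The line meets \<open>P\<^bsub>S\<^esub>\<close> if and only if \<open>p\<close> vanishes
  on \<open>S\<close>, so that the alternating sum of the indicator functions of the projected polytopes is
  \<open>\<Sum>S\<subseteq>Z. (-1)\<^bsup>|S|\<^esup>\<close> at that line, where \<open>Z \<noteq> {}\<close> is the zero set of \<open>p\<close> in \<open>C\<^sup>+\<close>. Hence it is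
  \<open>0\<close> everywhere (\<open>alternating_sum_projected_flows\<close>).

  Finally, a linear relation between indicator functions of compact convex sets remains true
  when each indicator function is replaced by the Euler characteristic, which is \<open>1\<close> for nonempty
  sets and \<open>0\<close> for the empty set (\<open>euler_relation_compact_convex\<close>). This turns the vanishing at
  every line into the vanishing of \<open>\<Sum>S\<subseteq>C\<^sup>+. (-1)\<^bsup>|S|\<^esup> [P\<^bsub>S\<^esub> \<noteq> {}]\<close>.
\<close>

section \<open>The Euler characteristic of compact convex sets\<close>

text \<open>
  The value of a combination of indicator functions of intervals jumps, when \<open>s\<close> is approached
  from the left, by the total coefficient of the intervals that start at \<open>s\<close>. If the
  combination vanishes, then so do all jumps, and every nonempty interval starts somewhere.
\<close>

lemma euler_relation_intervals:
  fixes a :: "'i \<Rightarrow> 'b::ab_group_add" and l u :: "'i \<Rightarrow> real"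
  assumes fin: "finite I"
    and zero: "\<And>s. (\<Sum>i | i \<in> I \<and> s \<in> {l i..u i}. a i) = 0"
  shows "(\<Sum>i | i \<in> I \<and> l i \<le> u i. a i) = 0"
proof -
  let ?J = "{i \<in> I. l i \<le> u i}"
  have finJ: "finite ?J" using fin by simp
  have start: "(\<Sum>i | i \<in> ?J \<and> l i = s. a i) = 0" for s
  proof -
    let ?T = "insert (s - 1) {t \<in> l ` I \<union> u ` I. t < s}"
    have finT: "finite ?T" using fin by simp
    have "Max ?T < s" using finT by (subst Max_less_iff) auto
    then obtain r where r: "Max ?T < r" "r < s" using dense by blast
    have below: "t < r" if "t \<in> l ` I \<union> u ` I" "t < s" for t
      using that Max_ge[OF finT, of t] r by fastforce
    have split: "{i. i \<in> I \<and> s \<in> {l i..u i}}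
        = {i. i \<in> I \<and> r \<in> {l i..u i}} \<union> {i. i \<in> ?J \<and> l i = s}"
    proof (intro equalityI subsetI)
      fix i assume i: "i \<in> {i. i \<in> I \<and> s \<in> {l i..u i}}"
      then show "i \<in> {i. i \<in> I \<and> r \<in> {l i..u i}} \<union> {i. i \<in> ?J \<and> l i = s}"
        using below[of "l i"] r(2) by (cases "l i = s") fastforce+
    next
      fix i assume i: "i \<in> {i. i \<in> I \<and> r \<in> {l i..u i}} \<union> {i. i \<in> ?J \<and> l i = s}"
      then show "i \<in> {i. i \<in> I \<and> s \<in> {l i..u i}}"
        using below[of "u i"] r(2) by fastforce
    qed
    have disj: "{i. i \<in> I \<and> r \<in> {l i..u i}} \<inter> {i. i \<in> ?J \<and> l i = s} = {}"
      using r(2) by auto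
    have "(\<Sum>i | i \<in> I \<and> s \<in> {l i..u i}. a i)
        = (\<Sum>i | i \<in> I \<and> r \<in> {l i..u i}. a i) + (\<Sum>i | i \<in> ?J \<and> l i = s. a i)"
      unfolding split using disj fin by (intro sum.union_disjoint) auto
    then show ?thesis using zero by simp
  qed
  have "sum a ?J = (\<Sum>s\<in>l ` ?J. \<Sum>i | i \<in> ?J \<and> l i = s. a i)"
    using finJ by (rule sum.image_gen)
  also have "\<dots> = 0" using start by (simp only: sum.neutral_const)
  finally show ?thesis .
qed

text \<open>
  Induction over the coordinates: the hyperplane sections in one coordinate direction are again
  compact and convex, and the sections that are nonempty are indexed by an interval. The Euler
  relation for intervals thus removes one coordinate constraint at a time.
\<close>

lemma euler_relation_sections:
  fixes K :: "'i \<Rightarrow> 'e::euclidean_space set" and a :: "'i \<Rightarrow> 'b::ab_group_add"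
  assumes "finite B" "finite I"
    and "\<And>i. i \<in> I \<Longrightarrow> compact (K i)" "\<And>i. i \<in> I \<Longrightarrow> convex (K i)"
    and "\<And>c. (\<Sum>i | i \<in> I \<and> K i \<inter> {x. \<forall>b\<in>B. x \<bullet> b = c b} \<noteq> {}. a i) = 0"
  shows "(\<Sum>i | i \<in> I \<and> K i \<noteq> {}. a i) = 0"
  using assms
proof (induction B arbitrary: K rule: finite_induct)
  case empty
  then show ?case by simp
next
  case (insert b B)
  have slice: "(\<Sum>i | i \<in> I \<and> K i \<inter> {x. x \<bullet> b = s} \<noteq> {}. a i) = 0" for s
  proof (rule insert.IH)
    show "finite I" by fact
    have hyperplane: "{x. x \<bullet> b = s} = {x. b \<bullet> x = s}" by (simp add: inner_commute)
    show "compact (K i \<inter> {x. x \<bullet> b = s})" if "i \<in> I" for i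
      unfolding hyperplane using insert.prems(2)[OF that] closed_hyperplane
      by (rule compact_Int_closed)
    show "convex (K i \<inter> {x. x \<bullet> b = s})" if "i \<in> I" for i
      unfolding hyperplane using insert.prems(3)[OF that] convex_hyperplane
      by (rule convex_Int)
    fix c
    have "K i \<inter> {x. x \<bullet> b = s} \<inter> {x. \<forall>b\<in>B. x \<bullet> b = c b}
        = K i \<inter> {x. \<forall>b'\<in>insert b B. x \<bullet> b' = (c(b := s)) b'}" for i
      using insert.hyps(2) by auto
    then show "(\<Sum>i | i \<in> I \<and> K i \<inter> {x. x \<bullet> b = s} \<inter> {x. \<forall>b\<in>B. x \<bullet> b = c b} \<noteq> {}. a i) = 0"
      using insert.prems(4)[of "c(b := s)"] by simp
  qed
  have "\<exists>l u. (\<lambda>x. x \<bullet> b) ` K i = {l..u}" if "i \<in> I" for i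
  proof -
    have "compact ((\<lambda>x. x \<bullet> b) ` K i)"
      by (intro compact_continuous_image continuous_intros insert.prems(2) that)
    moreover have "connected ((\<lambda>x. x \<bullet> b) ` K i)"
      by (intro connected_continuous_image continuous_intros convex_connected
          insert.prems(3) that)
    ultimately show ?thesis using connected_compact_interval_1 by auto
  qed
  then obtain l u where lu: "\<And>i. i \<in> I \<Longrightarrow> (\<lambda>x. x \<bullet> b) ` K i = {l i..u i}"
    by metis
  have "K i \<inter> {x. x \<bullet> b = s} \<noteq> {} \<longleftrightarrow> s \<in> {l i..u i}" if "i \<in> I" for i s
    unfolding lu[OF that, symmetric] by auto
  then have "(\<Sum>i | i \<in> I \<and> s \<in> {l i..u i}. a i) = 0" for s
    using slice[of s] by (simp cong: conj_cong)
  then have "(\<Sum>i | i \<in> I \<and> l i \<le> u i. a i) = 0"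
    by (rule euler_relation_intervals[OF insert.prems(1)])
  moreover have "K i \<noteq> {} \<longleftrightarrow> l i \<le> u i" if "i \<in> I" for i
    using lu[OF that] by (metis atLeastatMost_empty_iff2 image_is_empty)
  ultimately show ?case by (simp cong: conj_cong)
qed

text \<open>
  The Euler characteristic is well defined on the group generated by indicator functions of
  compact convex sets.
\<close>

theorem euler_relation_compact_convex:
  fixes K :: "'i \<Rightarrow> 'e::euclidean_space set" and a :: "'i \<Rightarrow> 'b::ab_group_add"
  assumes "finite I"
    and "\<And>i. i \<in> I \<Longrightarrow> compact (K i)" "\<And>i. i \<in> I \<Longrightarrow> convex (K i)"
    and zero: "\<And>x. (\<Sum>i | i \<in> I \<and> x \<in> K i. a i) = 0"
  shows "(\<Sum>i | i \<in> I \<and> K i \<noteq> {}. a i) = 0"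
proof (rule euler_relation_sections[OF finite_Basis assms(1-3)])
  fix c :: "'e \<Rightarrow> real"
  have "{x. \<forall>b\<in>Basis. x \<bullet> b = c b} = {\<Sum>b\<in>Basis. c b *\<^sub>R b}"
    by (auto simp: euclidean_eq_iff[where 'a='e])
  then show "(\<Sum>i | i \<in> I \<and> K i \<inter> {x. \<forall>b\<in>Basis. x \<bullet> b = c b} \<noteq> {}. a i) = 0"
    using zero[of "\<Sum>b\<in>Basis. c b *\<^sub>R b"] by simp
qed

lemma alternating_sum_Pow:
  assumes "finite Z" "Z \<noteq> {}"
  shows "(\<Sum>S\<in>Pow Z. (- 1) ^ card S) = (0::'b::comm_ring_1)"
proof -
  from assms(2) obtain z where z: "z \<in> Z" by blast
  let ?Y = "Z - {z}"
  have fin: "finite ?Y" using assms by simp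
  have Z: "Pow Z = Pow ?Y \<union> insert z ` Pow ?Y"
    using z Pow_insert[of z ?Y] by (simp add: insert_absorb)
  have "(\<Sum>S\<in>Pow Z. (- 1) ^ card S)
      = (\<Sum>S\<in>Pow ?Y. (- 1) ^ card S) + (\<Sum>S\<in>insert z ` Pow ?Y. (- 1 :: 'b) ^ card S)"
    unfolding Z using fin by (intro sum.union_disjoint) auto
  also have "(\<Sum>S\<in>insert z ` Pow ?Y. (- 1 :: 'b) ^ card S)
      = (\<Sum>S\<in>Pow ?Y. (- 1) ^ card (insert z S))"
    by (rule sum.reindex_cong[where l = "insert z"]) (auto intro!: inj_onI)
  also have "\<dots> = (\<Sum>S\<in>Pow ?Y. - ((- 1) ^ card S))"
  proof (rule sum.cong[OF refl])
    fix S assume S: "S \<in> Pow ?Y"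
    then have "finite S" using fin finite_subset by blast
    with S show "(- 1 :: 'b) ^ card (insert z S) = - ((- 1) ^ card S)"
      by (subst card_insert_disjoint) auto
  qed
  finally show ?thesis by (simp add: sum_negf)
qed

section \<open>The root polytope as a projection of a simplex\<close>

definition excess :: "real ^ ('v \<times> 'v) \<Rightarrow> real ^ 'v::finite" where
  "excess f = (\<Sum>e\<in>UNIV. (f $ e) *\<^sub>R (axis (snd e) 1 - axis (fst e) 1))"

text \<open>
  Flows on different edge sets share one ambient space, so that deleting edges means passing to
  a face of the simplex.
\<close>

definition flow_simplex :: "real \<Rightarrow> 'e set \<Rightarrow> (real ^ 'e::finite) set" where
  "flow_simplex w F = {f. (\<forall>e. 0 \<le> f $ e) \<and> (\<Sum>e\<in>UNIV. f $ e) = w \<and> (\<forall>e. e \<notin> F \<longrightarrow> f $ e = 0)}"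

lemma linear_excess: "linear excess"
  by (rule linearI)
    (simp_all add: excess_def scaleR_add_left sum.distrib scaleR_sum_right)

lemma excess_axis: "excess (axis e 1) = axis (snd e) 1 - axis (fst e) 1"
proof -
  have "excess (axis e 1)
      = (\<Sum>e'\<in>UNIV. if e' = e then axis (snd e') 1 - axis (fst e') 1 else 0)"
    unfolding excess_def by (intro sum.cong) (auto simp: axis_def)
  then show ?thesis by simp
qed

lemma vec_eq_sum_axis:
  fixes f :: "real ^ 'e::finite"
  shows "f = (\<Sum>e\<in>UNIV. (f $ e) *\<^sub>R axis e 1)"
  by (simp add: vec_eq_iff sum_component axis_def if_distrib cong: if_cong)

lemma convex_flow_simplex: "convex (flow_simplex w F)"
proof (rule convexI)
  fix f g :: "real ^ 'a" and s t :: real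
  assume fg: "f \<in> flow_simplex w F" "g \<in> flow_simplex w F" and st: "0 \<le> s" "0 \<le> t" "s + t = 1"
  have "(\<Sum>e\<in>UNIV. (s *\<^sub>R f + t *\<^sub>R g) $ e) = s * w + t * w"
    using fg by (simp add: flow_simplex_def sum.distrib sum_distrib_left[symmetric])
  also have "\<dots> = w" using st(3) by (simp add: distrib_right[symmetric])
  finally show "s *\<^sub>R f + t *\<^sub>R g \<in> flow_simplex w F"
    using fg st by (auto simp: flow_simplex_def)
qed

lemma compact_flow_simplex: "compact (flow_simplex w F)"
proof -
  have "norm f \<le> w" if "f \<in> flow_simplex w F" for f :: "real ^ 'a"
    using that norm_le_l1_cart[of f] by (simp add: flow_simplex_def)
  then have "bounded (flow_simplex w F)" by (rule boundedI)
  moreover have "closed (flow_simplex w F)"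
  proof -
    have eq: "flow_simplex w F
        = (\<Inter>e. {f. 0 \<le> f $ e}) \<inter> {f. (\<Sum>e\<in>UNIV. f $ e) = w} \<inter> (\<Inter>e\<in>- F. {f. f $ e = 0})"
      unfolding flow_simplex_def by auto
    show ?thesis unfolding eq
      by (intro closed_Int closed_INT ballI closed_Collect_le closed_Collect_eq continuous_intros)
  qed
  ultimately show ?thesis by (simp add: compact_eq_bounded_closed)
qed

lemma flow_simplex_eq_convex_hull:
  "flow_simplex 1 F = convex hull ((\<lambda>e. axis e 1) ` F)"
proof (intro equalityI subsetI)
  fix f assume f: "f \<in> flow_simplex 1 F"
  have "f = (\<Sum>e\<in>F. (f $ e) *\<^sub>R axis e 1)"
    using f by (subst vec_eq_sum_axis, intro sum.mono_neutral_right) (auto simp: flow_simplex_def)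
  also have "\<dots> \<in> convex hull ((\<lambda>e. axis e 1) ` F)"
  proof (rule convex_sum)
    have "(\<Sum>e\<in>F. f $ e) = (\<Sum>e\<in>UNIV. f $ e)"
      using f by (intro sum.mono_neutral_left) (auto simp: flow_simplex_def)
    then show "(\<Sum>e\<in>F. f $ e) = 1" using f by (simp add: flow_simplex_def)
  qed (use f in \<open>auto simp: flow_simplex_def intro: hull_inc\<close>)
  finally show "f \<in> convex hull ((\<lambda>e. axis e 1) ` F)" .
next
  fix f assume "f \<in> convex hull ((\<lambda>e. axis e (1::real)) ` F)"
  moreover have "(\<lambda>e. axis e 1) ` F \<subseteq> flow_simplex 1 F"
    by (auto simp: flow_simplex_def axis_def)
  ultimately show "f \<in> flow_simplex 1 F"
    using hull_minimal[of _ _ convex] convex_flow_simplex by blast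
qed

lemma scaled_flow_simplex:
  assumes "0 < w"
  shows "flow_simplex w F = (\<lambda>f. w *\<^sub>R f) ` flow_simplex 1 F"
proof (intro equalityI subsetI)
  fix f assume f: "f \<in> flow_simplex w F"
  have "(1 / w) *\<^sub>R f \<in> flow_simplex 1 F"
    using f assms by (auto simp: flow_simplex_def sum_divide_distrib[symmetric])
  moreover have "f = w *\<^sub>R ((1 / w) *\<^sub>R f)" using assms by simp
  ultimately show "f \<in> (\<lambda>f. w *\<^sub>R f) ` flow_simplex 1 F" by blast
next
  fix f assume "f \<in> (\<lambda>f. w *\<^sub>R f) ` flow_simplex 1 F"
  then show "f \<in> flow_simplex w F"
    using assms by (auto simp: flow_simplex_def sum_distrib_left[symmetric])
qed

lemma scaled_root_polytope:
  assumes "0 < w"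
  shows "(\<lambda>x. w *\<^sub>R x) ` root_polytope F = excess ` flow_simplex w F"
proof -
  have gen: "{axis h 1 - axis t 1 | t h. (t, h) \<in> F} = excess ` (\<lambda>e. axis e 1) ` F"
    by (force simp: image_image excess_axis)
  have "root_polytope F = excess ` flow_simplex 1 F"
    unfolding root_polytope_def gen flow_simplex_eq_convex_hull
    by (rule convex_hull_linear_image[OF linear_excess, symmetric])
  then show ?thesis
    by (simp add: scaled_flow_simplex[OF assms] image_image linear_cmul[OF linear_excess])
qed

section \<open>The circulation around a cycle\<close>

definition cycle_circulation :: "('v::finite \<times> 'v) set \<Rightarrow> 'v list \<Rightarrow> real ^ ('v \<times> 'v)" where
  "cycle_circulation E vs =
     (\<Sum>e\<in>forward_edges E vs. axis e 1) - (\<Sum>e\<in>backward_edges E vs. axis e 1)"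

lemma cycle_circulation_nth:
  "cycle_circulation E vs $ e =
     of_bool (e \<in> forward_edges E vs) - of_bool (e \<in> backward_edges E vs)"
  by (simp add: cycle_circulation_def sum_component axis_def)

text \<open>
  If a step of the cycle were also the reverse of a step, then two steps would lead back to the
  same vertex, so that the length of the cycle would divide \<open>2\<close>.
\<close>

lemma forward_backward_edges_disjoint:
  assumes "is_cycle E vs"
  shows "forward_edges E vs \<inter> backward_edges E vs = {}"
proof -
  let ?n = "length vs"
  have n: "3 \<le> ?n" and dist: "distinct vs" using assms by (auto simp: is_cycle_def)
  have False if ij: "i < ?n" "j < ?n" "vs ! i = vs ! (Suc j mod ?n)"
    "vs ! (Suc i mod ?n) = vs ! j" for i j
  proof -
    have "0 < ?n" using n by linarith
    then have "Suc j mod ?n < ?n" "Suc i mod ?n < ?n" by simp_all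
    then have "i = Suc j mod ?n" "Suc i mod ?n = j"
      using ij nth_eq_iff_index_eq[OF dist] by blast+
    then show False using n ij(1,2) by (auto simp: mod_Suc split: if_splits)
  qed
  then show ?thesis
    unfolding forward_edges_def backward_edges_def cycle_steps_def by fastforce
qed

lemma cycle_steps_eq:
  assumes "is_cycle E vs"
  shows "cycle_steps vs = forward_edges E vs \<union> (backward_edges E vs)\<inverse>"
  using assms unfolding is_cycle_def forward_edges_def backward_edges_def by auto

lemma forward_backward_steps_disjoint:
  assumes "oriented_graph E"
  shows "forward_edges E vs \<inter> (backward_edges E vs)\<inverse> = {}"
  using assms unfolding oriented_graph_def forward_edges_def backward_edges_def by auto

lemma forward_edges_nonempty:
  fixes E :: "('v::finite \<times> 'v) set"
  assumes "semi_balanced E" "is_cycle E vs"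
  shows "forward_edges E vs \<noteq> {}"
proof
  assume empty: "forward_edges E vs = {}"
  then have "backward_edges E vs = {}"
    using assms unfolding semi_balanced_def by (metis card.empty card_0_eq finite)
  then have "cycle_steps vs = {}" using empty cycle_steps_eq[OF assms(2)] by simp
  moreover have "0 < length vs" using assms(2) by (auto simp: is_cycle_def)
  ultimately show False unfolding cycle_steps_def by auto
qed

text \<open>
  The reversal of a backward edge is a step of the cycle and has the opposite excess. The excess
  of the circulation is therefore the sum of \<open>\<^bold>h - \<^bold>t\<close> over all steps, which telescopes.
\<close>

lemma excess_cycle_circulation:
  assumes "oriented_graph E" "is_cycle E vs"
  shows "excess (cycle_circulation E vs) = 0"
proof -
  let ?n = "length vs" and ?a = "\<lambda>v. axis v 1 :: real ^ 'a"
  let ?step = "\<lambda>e. ?a (snd e) - ?a (fst e)"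
  have dist: "distinct vs" using assms(2) by (simp add: is_cycle_def)
  have "excess (cycle_circulation E vs)
      = sum ?step (forward_edges E vs) - sum ?step (backward_edges E vs)"
    by (simp add: cycle_circulation_def linear_diff[OF linear_excess]
        linear_sum[OF linear_excess] excess_axis)
  also have "sum ?step (backward_edges E vs) = (\<Sum>e\<in>(backward_edges E vs)\<inverse>. - ?step e)"
    by (rule sum.reindex_bij_witness[of _ prod.swap prod.swap]) auto
  also have "\<dots> = - sum ?step ((backward_edges E vs)\<inverse>)"
    by (rule sum_negf)
  also have "sum ?step (forward_edges E vs) - \<dots> = sum ?step (cycle_steps vs)"
    unfolding cycle_steps_eq[OF assms(2)]
    by (subst sum.union_disjoint) (use forward_backward_steps_disjoint[OF assms(1)] in auto)
  also have "\<dots> = (\<Sum>i<?n. ?a (vs ! (Suc i mod ?n)) - ?a (vs ! i))"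
    by (rule sum.reindex_cong[where l = "\<lambda>i. (vs ! i, vs ! (Suc i mod ?n))"])
      (auto simp: cycle_steps_def inj_on_def nth_eq_iff_index_eq[OF dist])
  also have "\<dots> = (\<Sum>i<?n. ?a (vs ! (Suc i mod ?n))) - (\<Sum>i<?n. ?a (vs ! i))"
    by (rule sum_subtractf)
  \<comment> \<open>Rotating the cycle permutes its vertices.\<close>
  also have "(\<Sum>i<?n. ?a (vs ! (Suc i mod ?n))) = (\<Sum>i<?n. ?a (rotate1 vs ! i))"
    by (rule sum.cong) (auto simp: nth_rotate1)
  also have "\<dots> = (\<Sum>v\<in>set vs. ?a v)"
    using sum_code[of ?a "rotate1 vs"] dist
    by (simp add: sum_list_sum_nth atLeast0LessThan distinct_remdups_id)
  also have "(\<Sum>i<?n. ?a (vs ! i)) = (\<Sum>v\<in>set vs. ?a v)"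
    using sum_code[of ?a vs] dist
    by (simp add: sum_list_sum_nth atLeast0LessThan distinct_remdups_id)
  finally show ?thesis by simp
qed

text \<open>
  Semi-balancedness makes the two directions cancel, so that moving along the circulation keeps
  the total weight of a flow.
\<close>

lemma sum_cycle_circulation:
  assumes "semi_balanced E" "is_cycle E vs"
  shows "(\<Sum>e\<in>UNIV. cycle_circulation E vs $ e) = 0"
  using assms
  by (simp add: cycle_circulation_nth sum_subtractf semi_balanced_def of_bool_def
      sum.If_cases)

section \<open>Projecting the flow polytopes along the circulation\<close>

text \<open>
  Each fibre of the projection \<open>f \<mapsto> f - f\<^sub>e \<gamma>\<close> is a line parallel to the circulation \<open>\<gamma>\<close>. If it
  meets the flow polytope, it leaves it, in the direction \<open>-\<gamma>\<close>, through the point \<open>p\<close> where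
  the minimum over the forward edges becomes \<open>0\<close>, and \<open>p\<close> is the only common point of the line
  and the polytope where a forward edge vanishes.
\<close>

lemma alternating_sum_projected_flows:
  fixes E :: "('v::finite \<times> 'v) set" and e\<^sub>0 :: "'v \<times> 'v"
    and vs :: "'v list" and w :: real and x :: "real ^ 'v"
  defines "\<gamma> \<equiv> cycle_circulation E vs"
  defines "P \<equiv> \<lambda>S. flow_simplex w (E - S) \<inter> {f. excess f = x}"
  defines "\<pi> \<equiv> \<lambda>f. f - (f $ e\<^sub>0) *\<^sub>R \<gamma>"
  assumes "oriented_graph E" "semi_balanced E" "is_cycle E vs"
    and e0: "e\<^sub>0 \<in> forward_edges E vs"
  shows "(\<Sum>S | S \<in> Pow (forward_edges E vs) \<and> y \<in> \<pi> ` P S. (- 1) ^ card S) = (0::'b::comm_ring_1)"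
proof (cases "y \<in> \<pi> ` P {}")
  case False
  have "P S \<subseteq> P {}" for S by (auto simp: P_def flow_simplex_def)
  then have "{S. S \<in> Pow (forward_edges E vs) \<and> y \<in> \<pi> ` P S} = {}" using False by blast
  then show ?thesis by (simp only: sum.empty)
next
  case True
  let ?F = "forward_edges E vs" and ?B = "backward_edges E vs"
  have disj: "?F \<inter> ?B = {}" by (rule forward_backward_edges_disjoint) fact
  have circ_F: "\<gamma> $ e = 1" if "e \<in> ?F" for e
    using that disj by (auto simp: \<gamma>_def cycle_circulation_nth)
  have circ_not_F: "\<gamma> $ e \<le> 0" if "e \<notin> ?F" for e
    using that by (auto simp: \<gamma>_def cycle_circulation_nth)
  have circ_E: "\<gamma> $ e = 0" if "e \<notin> E" for e
    using that by (auto simp: \<gamma>_def cycle_circulation_nth forward_edges_def backward_edges_def)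
  obtain f where f: "f \<in> P {}" "y = \<pi> f" using True by blast
  define m where "m = Min (($) f ` ?F)"
  define p where "p = f - m *\<^sub>R \<gamma>"
  define Z where "Z = {e \<in> ?F. p $ e = 0}"
  have m_le: "m \<le> f $ e" if "e \<in> ?F" for e
    unfolding m_def using that by (intro Min_le) auto
  have "m \<in> ($) f ` ?F" unfolding m_def using e0 by (intro Min_in) auto
  then obtain z where z: "z \<in> ?F" "f $ z = m" by auto
  then have Z: "z \<in> Z" by (simp add: Z_def p_def circ_F)
  have m_nonneg: "0 \<le> m" using z(2) f(1) unfolding P_def flow_simplex_def by blast
  have p_nonneg: "0 \<le> p $ e" for e
  proof (cases "e \<in> ?F")
    case True
    then show ?thesis using m_le by (simp add: p_def circ_F)
  next
    case False
    then have "m * \<gamma> $ e \<le> 0" using m_nonneg circ_not_F by (simp add: mult_nonneg_nonpos)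
    moreover have "0 \<le> f $ e" using f(1) unfolding P_def flow_simplex_def by blast
    ultimately show ?thesis by (simp add: p_def)
  qed
  have p_P: "p \<in> P S" if "S \<subseteq> Z" for S
  proof -
    have "(\<Sum>e\<in>UNIV. p $ e) = w"
      using f(1) sum_cycle_circulation[OF assms(5,6)]
      by (simp add: p_def P_def flow_simplex_def sum_subtractf \<gamma>_def sum_distrib_left[symmetric])
    moreover have "excess p = x"
      using f(1) excess_cycle_circulation[OF assms(4,6)]
      by (simp add: p_def P_def \<gamma>_def linear_diff[OF linear_excess] linear_cmul[OF linear_excess])
    moreover have "p $ e = 0" if "e \<notin> E - S" for e
    proof (cases "e \<in> E")
      case True
      then show ?thesis using that \<open>S \<subseteq> Z\<close> by (auto simp: Z_def)
    next
      case False
      then have "f $ e = 0" using f(1) unfolding P_def flow_simplex_def by blast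
      then show ?thesis using False by (simp add: p_def circ_E)
    qed
    ultimately show ?thesis using p_nonneg by (simp add: P_def flow_simplex_def)
  qed
  have pi_p: "\<pi> p = y"
    using f(2) by (simp add: \<pi>_def p_def circ_F[OF e0] scaleR_diff_left)
  have "y \<in> \<pi> ` P S \<longleftrightarrow> S \<subseteq> Z" if S: "S \<subseteq> ?F" for S
  proof
    assume "S \<subseteq> Z"
    then show "y \<in> \<pi> ` P S" using p_P pi_p by blast
  next
    assume "y \<in> \<pi> ` P S"
    then obtain g where g: "g \<in> P S" "\<pi> g = \<pi> p" using pi_p by auto
    define s where "s = g $ e\<^sub>0 - p $ e\<^sub>0"
    have g_eq: "g = p + s *\<^sub>R \<gamma>"
      using g(2) by (simp add: \<pi>_def s_def scaleR_diff_left algebra_simps)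
    have "0 \<le> g $ z" using g(1) unfolding P_def flow_simplex_def by blast
    then have s: "0 \<le> s" using Z by (simp add: g_eq circ_F Z_def)
    show "S \<subseteq> Z"
    proof
      fix e assume e: "e \<in> S"
      then have "g $ e = 0" using g(1) unfolding P_def flow_simplex_def by blast
      then have "p $ e = - s" using e S by (auto simp: g_eq circ_F)
      then have "p $ e = 0" using s p_nonneg[of e] by linarith
      then show "e \<in> Z" using e S by (auto simp: Z_def)
    qed
  qed
  then have "{S. S \<in> Pow ?F \<and> y \<in> \<pi> ` P S} = Pow Z" by (auto simp: Z_def)
  moreover have "finite Z" by simp
  ultimately show ?thesis using alternating_sum_Pow[of Z] Z by auto
qed

text \<open>
  The Euler relation is applied to the projections of the polytopes of flows with excess \<open>x\<close>,
  and not to these polytopes themselves: only after the projection does the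
  alternating sum of the indicator functions vanish.
\<close>

lemma alternating_sum_scaled_root_polytopes:
  fixes E :: "('v::finite \<times> 'v) set"
  assumes "oriented_graph E" "semi_balanced E" "is_cycle E vs" "0 < w"
  shows "(\<Sum>S | S \<in> Pow (forward_edges E vs) \<and> x \<in> (\<lambda>x. w *\<^sub>R x) ` root_polytope (E - S).
            (- 1) ^ card S) = (0::'b::comm_ring_1)"
proof -
  obtain e\<^sub>0 where e0: "e\<^sub>0 \<in> forward_edges E vs"
    using forward_edges_nonempty[OF assms(2,3)] by blast
  define \<pi> where "\<pi> = (\<lambda>f. f - (f $ e\<^sub>0) *\<^sub>R cycle_circulation E vs)"
  define P where "P = (\<lambda>S. flow_simplex w (E - S) \<inter> {f. excess f = x})"
  have lin: "linear \<pi>"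
    unfolding \<pi>_def by (rule linearI) (simp_all add: algebra_simps)
  have "closed {f. excess f = x}"
    by (intro closed_Collect_eq linear_continuous_on linear_excess continuous_on_const
        linear_conv_bounded_linear[THEN iffD1])
  then have compact: "compact (\<pi> ` P S)" for S
    unfolding P_def
    by (intro compact_continuous_image compact_Int_closed compact_flow_simplex
        linear_continuous_on linear_conv_bounded_linear[THEN iffD1] lin)
  have "convex {f. excess f = x}"
    using convex_linear_vimage[OF linear_excess convex_singleton[of x]]
    by (simp add: vimage_def)
  then have convex: "convex (\<pi> ` P S)" for S
    unfolding P_def by (intro convex_linear_image lin convex_Int convex_flow_simplex)
  have "(\<Sum>S | S \<in> Pow (forward_edges E vs) \<and> \<pi> ` P S \<noteq> {}. (- 1) ^ card S) = (0::'b)"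
    using alternating_sum_projected_flows[OF assms(1-3) e0, where w = w and x = x and 'b = 'b]
    by (intro euler_relation_compact_convex compact convex) (simp_all add: \<pi>_def P_def)
  moreover have "x \<in> (\<lambda>x. w *\<^sub>R x) ` root_polytope (E - S) \<longleftrightarrow> \<pi> ` P S \<noteq> {}" for S
    unfolding scaled_root_polytope[OF assms(4)] P_def by auto
  ultimately show ?thesis by simp
qed

section \<open>Counting lattice points\<close>

lemma finite_integer_points_bounded:
  fixes Q :: "(real ^ 'v::finite) set"
  assumes "bounded Q"
  shows "finite (Q \<inter> integer_points)"
proof -
  obtain r where r: "\<And>x. x \<in> Q \<Longrightarrow> norm x \<le> r" using assms bounded_iff by blast
  define N where "N = \<lceil>r\<rceil>"
  have "Q \<inter> integer_points \<subseteq> vec_lambda ` (UNIV \<rightarrow>\<^sub>E real_of_int ` {- N..N})"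
  proof
    fix x assume x: "x \<in> Q \<inter> integer_points"
    have "x $ i \<in> real_of_int ` {- N..N}" for i
    proof -
      obtain k where k: "x $ i = of_int k" using x by (auto simp: integer_points_def elim: Ints_cases)
      have "\<bar>x $ i\<bar> \<le> r" using x r component_le_norm_cart order_trans by blast
      then have "- N \<le> k \<and> k \<le> N" unfolding N_def using k by linarith
      then show ?thesis using k by auto
    qed
    then have "($) x \<in> UNIV \<rightarrow>\<^sub>E real_of_int ` {- N..N}" by auto
    then show "x \<in> vec_lambda ` (UNIV \<rightarrow>\<^sub>E real_of_int ` {- N..N})"
      by (metis image_eqI vec_nth_inverse)
  qed
  then show ?thesis by (rule finite_subset) (intro finite_imageI finite_PiE, auto)
qed

lemma alternating_sum_lattice_points:
  fixes E :: "('v::finite \<times> 'v) set"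
  assumes "oriented_graph E" "semi_balanced E" "is_cycle E vs" "0 < w"
  shows "(\<Sum>S\<in>Pow (forward_edges E vs). (- 1) ^ card S *
            int (card ((\<lambda>x. w *\<^sub>R x) ` root_polytope (E - S) \<inter> integer_points))) = 0"
proof -
  let ?Q = "\<lambda>S. (\<lambda>x. w *\<^sub>R x) ` root_polytope (E - S)" and ?F = "forward_edges E vs"
  define A where "A = ?Q {} \<inter> integer_points"
  have "bounded (?Q {})"
    unfolding scaled_root_polytope[OF assms(4)]
    by (intro compact_imp_bounded compact_continuous_image compact_flow_simplex
        linear_continuous_on linear_conv_bounded_linear[THEN iffD1] linear_excess)
  then have finA: "finite A" unfolding A_def by (rule finite_integer_points_bounded)
  have "?Q S \<subseteq> ?Q {}" for S
    unfolding root_polytope_def by (intro image_mono hull_mono) auto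
  then have "?Q S \<inter> integer_points = {x \<in> A. x \<in> ?Q S}" for S unfolding A_def by blast
  then have "(\<Sum>S\<in>Pow ?F. (- 1) ^ card S * int (card (?Q S \<inter> integer_points)))
      = (\<Sum>S\<in>Pow ?F. \<Sum>x\<in>A. if x \<in> ?Q S then (- 1) ^ card S else 0)"
    using finA by (simp add: sum.If_cases Int_def mult.commute)
  also have "\<dots> = (\<Sum>x\<in>A. \<Sum>S\<in>Pow ?F. if x \<in> ?Q S then (- 1) ^ card S else 0)"
    by (rule sum.swap)
  also have "\<dots> = (\<Sum>x\<in>A. \<Sum>S | S \<in> Pow ?F \<and> x \<in> ?Q S. (- 1) ^ card S)"
    by (intro sum.cong refl sum.inter_filter[symmetric]) simp
  also have "\<dots> = 0"
    using alternating_sum_scaled_root_polytopes[OF assms, where 'b = int] by simp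
  finally show ?thesis .
qed

theorem theorem11p5:
  fixes E :: "('v::finite \<times> 'v) set" and C :: "'v list"
  assumes "oriented_graph E" and "semi_balanced E" and "is_cycle E C"
  shows "(\<Sum>S \<in> Pow (forward_edges E C). (- 1) ^ card S * interior_polynomial (E - S)) = 0"
proof -
  let ?F = "forward_edges E C"
  have sign_nth: "fps_nth ((- 1) ^ n * f) k = (- 1) ^ n * fps_nth f k" for n k and f :: "int fps"
    by (cases "even n") simp_all
  have "(\<Sum>S\<in>Pow ?F. (- 1) ^ card S * ehrhart_series (root_polytope (E - S))) = 0"
  proof (rule fps_ext)
    fix k
    show "fps_nth (\<Sum>S\<in>Pow ?F. (- 1) ^ card S * ehrhart_series (root_polytope (E - S))) k
        = fps_nth 0 k"
    proof (cases "k = 0")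
      case True
      then show ?thesis
        using alternating_sum_Pow[OF _ forward_edges_nonempty[OF assms(2,3)], where 'b = int]
        by (simp add: fps_sum_nth sign_nth ehrhart_series_def del: fps_mult_nth_0)
    next
      case False
      then show ?thesis
        using alternating_sum_lattice_points[OF assms, of "real k"]
        by (simp add: fps_sum_nth sign_nth ehrhart_series_def)
    qed
  qed
  moreover have "(\<Sum>S\<in>Pow ?F. (- 1) ^ card S * interior_polynomial (E - S))
      = (1 - fps_X) ^ (CARD('v) - 1)
        * (\<Sum>S\<in>Pow ?F. (- 1) ^ card S * ehrhart_series (root_polytope (E - S)))"
    by (simp add: interior_polynomial_def sum_distrib_left mult.left_commute)
  ultimately show ?thesis by simp
qed

end
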